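(* Consider an instance of the PRTRP with $n$ fault locations. Given an outgoing path $P$ that contains $k$ vertices in $V_c$, let $w_P$ be the number of vertices without power service after the crew travels through $P$. Then the total service disruption time of any Hamiltonian cycle extended from $P$ is lower bounded by $$u^F(P)+w_P s_1+\sum_{p=2}^{n-k}(n-k+1-p)\,s_p.$$
   Context: Instance of the Power Restoration Traveling Repairman Problem (PRTRP): Let $n\ge 1$, let $V_c=\{1,2,\dots,n\}$ be the set of fault locations (customers), let vertex $0$ be the depot, and let $V=V_c\cup\{0\}$. The road network is a complete directed graph $G=(V,A)$, where each arc $(i,j)\in A$ ($i\neq j$) represents a shortest path from location $i$ to location $j$ and has travel time (length) $d_{ij}\ge 0$. The power network is a directed tree $T=(V_c,A_c)$ rooted at vertex $1$ (the unique power source, with all arcs directed away from it). Write $i\succeq j$ if $i=j$ or $j$ is reachable from $i$ by a directed path in $T$. Repair durations are zero. Solutions and objective: A solution is a Hamiltonian cycle $H=(j_0=0,j_1,\dots,j_n,0)$ in $G$ starting at the depot. The crew leaves the depot at time $0$ and arrives at $j_p$ at time $t_{j_p}=\sum_{q=1}^{p}d_{j_{q-1}j_q}$, repairing the fault there instantaneously. The service disruption time of $j\in V_c$ is $r_j=\max\{t_i : i\succeq j\}$. The total service disruption time of $H$ is $\sum_{j\in V_c}r_j$. For $S\subseteq V$, let $W(S)$ be the number of vertices $j\in V_c$ without power when exactly the vertices in $S\cap V_c$ have been repaired, i.e., the number of $j\in V_c$ such that some $i\succeq j$ is not in $S$. Outgoing paths: An outgoing path is a (simple) path $P$ in $G$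 that starts at vertex $0$ and ends at some vertex $i\in V_c$; $V(P)$ is its set of vertices. $u^F(P)$ is the service disruption time accumulated by all customers in $V_c$ between the time the vehicle leaves the depot and the time it arrives at the end vertex of $P$ following $P$; explicitly, if $P=(i_0=0,i_1,\dots,i_k)$ then $u^F(P)=\sum_{q=1}^{k}W(\{i_0,\dots,i_{q-1}\})\,d_{i_{q-1}i_q}$. The number $w_P$ equals $W(V(P))$ (all vertices of $P$, including its last one, have been repaired). A Hamiltonian cycle is extended from $P$ if it starts with $P$, i.e., it is the concatenation of $P$ with a path ending at $0$. Notation: $s_p$ is the length of the $p$-th shortest arc in the road network $G$ (arc lengths sorted in non-decreasing order, with multiplicity). Empty sums are zero. *)

theory Defs
  imports
    "HOL-Library.Multiset"
    "HOL-Library.Sublist"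
    "Graph_Theory.Graph_Theory"
begin

text \<open>The vertices are natural numbers: 0 is the depot and 1, ..., n are the customers.\<close>

definition road_network :: "nat \<Rightarrow> nat pair_pre_digraph" where
  "road_network n = \<lparr>pverts = {0..n}, parcs = {(i, j). i \<in> {0..n} \<and> j \<in> {0..n} \<and> i \<noteq> j}\<rparr>"

text \<open>The constant \<^const>\<open>tree\<close> is meant for symmetric digraphs (its forests merely have no directed
  cycle), so a directed tree with all arcs pointing away from its root is defined here.\<close>

definition directed_tree :: "'a pair_pre_digraph \<Rightarrow> 'a \<Rightarrow> bool" where
  "directed_tree T r \<longleftrightarrow> pair_fin_digraph T \<and> r \<in> pverts T \<and>
     (\<forall>v\<in>pverts T. \<exists>!p. pre_digraph.awalk (with_proj T) r p v)"

locale prtrp_instance =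
  fixes n :: nat and d :: "nat \<Rightarrow> nat \<Rightarrow> real" and T :: "nat pair_pre_digraph"
  assumes n_ge_1: "n \<ge> 1"
    and travel_time_nonneg: "(i, j) \<in> parcs (road_network n) \<Longrightarrow> d i j \<ge> 0"
    and customers: "pverts T = {1..n}"
    and power_network: "directed_tree T 1"

text \<open>Cycles and paths in the road network are given by their vertex sequences; a Hamiltonian cycle
  lists its starting vertex 0 also at the end.\<close>

definition hamiltonian_cycle :: "nat \<Rightarrow> nat list \<Rightarrow> bool" where
  "hamiltonian_cycle n H \<longleftrightarrow> vwalk H (road_network n) \<and> hd H = 0 \<and> last H = 0 \<and>
     tl H \<noteq> [] \<and> distinct (tl H) \<and> set H = pverts (road_network n)"

definition outgoing_path :: "nat \<Rightarrow> nat list \<Rightarrow> bool" where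
  "outgoing_path n P \<longleftrightarrow> vpath P (road_network n) \<and> hd P = 0 \<and> last P \<in> {1..n}"

text \<open>The index bound is the first position of \<^term>\<open>i\<close> in \<^term>\<open>H\<close>; it is the only one if
  \<^term>\<open>H\<close> is a Hamiltonian cycle and \<^term>\<open>i\<close> is a customer.\<close>

definition arrival_time :: "(nat \<Rightarrow> nat \<Rightarrow> real) \<Rightarrow> nat list \<Rightarrow> nat \<Rightarrow> real" where
  "arrival_time d H i = (\<Sum>q = 1..(LEAST p. H ! p = i). d (H ! (q - 1)) (H ! q))"

text \<open>Reachability is reflexive on the vertices of the power network.\<close>

definition disruption_time ::
    "(nat \<Rightarrow> nat \<Rightarrow> real) \<Rightarrow> nat pair_pre_digraph \<Rightarrow> nat list \<Rightarrow> nat \<Rightarrow> real" where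
  "disruption_time d T H j = Max {arrival_time d H i | i. i \<rightarrow>\<^sup>*\<^bsub>with_proj T\<^esub> j}"

definition total_disruption_time ::
    "(nat \<Rightarrow> nat \<Rightarrow> real) \<Rightarrow> nat pair_pre_digraph \<Rightarrow> nat list \<Rightarrow> real" where
  "total_disruption_time d T H = (\<Sum>j\<in>pverts T. disruption_time d T H j)"

text \<open>The number of customers without power once exactly the customers in \<^term>\<open>S\<close> are repaired.\<close>

definition unpowered :: "nat pair_pre_digraph \<Rightarrow> nat set \<Rightarrow> nat" where
  "unpowered T S = card {j \<in> pverts T. \<exists>i. i \<rightarrow>\<^sup>*\<^bsub>with_proj T\<^esub> j \<and> i \<notin> S}"

definition path_disruption_time ::
    "(nat \<Rightarrow> nat \<Rightarrow> real) \<Rightarrow> nat pair_pre_digraph \<Rightarrow> nat list \<Rightarrow> real" where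
  "path_disruption_time d T P =
     (\<Sum>q = 1..length P - 1. real (unpowered T (set (take q P))) * d (P ! (q - 1)) (P ! q))"

definition sorted_arc_lengths :: "nat \<Rightarrow> (nat \<Rightarrow> nat \<Rightarrow> real) \<Rightarrow> real list" where
  "sorted_arc_lengths n d =
     sorted_list_of_multiset (image_mset (\<lambda>(i, j). d i j) (mset_set (parcs (road_network n))))"

text \<open>The length of the \<^term>\<open>p\<close>-th shortest arc, counting from \<^prop>\<open>p = 1\<close>.\<close>

definition shortest_arc_length :: "nat \<Rightarrow> (nat \<Rightarrow> nat \<Rightarrow> real) \<Rightarrow> nat \<Rightarrow> real" where
  "shortest_arc_length n d p = sorted_arc_lengths n d ! (p - 1)"

end

theory Submission
  imports Defs
begin

text \<open>
  Counting the accumulated disruption by travelled arcs instead of by customers turns the objective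
  into a weighted sum of arc lengths: while the crew travels an arc, disruption accumulates at the
  rate given by the number of customers without power, so a Hamiltonian cycle \<open>H\<close> costs
  \<^term>\<open>path_disruption_time d T H\<close> (lemma \<open>total_disruption_time_eq\<close>). The part of this sum that
  belongs to the arcs of \<open>P\<close> is exactly \<^term>\<open>path_disruption_time d T P\<close>.

  On the remaining arcs, the rate is \<open>w\<close> on the first one, and on the \<open>p\<close>-th one it is at least the
  number \<open>n - k + 1 - p\<close> of customers not yet visited, because an unrepaired customer has no power.
  These weights decrease with \<open>p\<close>, and the arcs are distinct, so any first \<open>t\<close> of them are together
  at least as long as the \<open>t\<close> shortest arcs of the network
  (lemma \<open>sum_shortest_arc_lengths_le\<close>). Summation by parts combines the two facts
  (lemma \<open>weighted_sum_mono_partial_sums\<close>).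
\<close>

section \<open>Weighted sums and smallest elements\<close>

text \<open>Summation by parts: the weighted sum is a combination of the partial sums with the nonnegative
  coefficients \<open>c t - c (t + 1)\<close> for \<open>t < m\<close>, plus \<open>c m\<close> times the full sum. Keeping that last summand
  as the lower bound, instead of \<open>0\<close>, makes the induction go through.\<close>

lemma weighted_sum_ge_last_weight:
  fixes c x :: "nat \<Rightarrow> 'a::linordered_idom"
  assumes "\<And>p. 1 \<le> p \<Longrightarrow> p < m \<Longrightarrow> c (Suc p) \<le> c p"
    and "\<And>t. t \<le> m \<Longrightarrow> 0 \<le> (\<Sum>p = 1..t. x p)"
  shows "c m * (\<Sum>p = 1..m. x p) \<le> (\<Sum>p = 1..m. c p * x p)"
  using assms
proof (induction m)
  case 0
  then show ?case by simp
next
  case (Suc m)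
  have "c (Suc m) * (\<Sum>p = 1..m. x p) \<le> c m * (\<Sum>p = 1..m. x p)"
  proof (cases "m = 0")
    case False
    then show ?thesis
      by (intro mult_right_mono Suc.prems) simp_all
  qed simp
  also have "\<dots> \<le> (\<Sum>p = 1..m. c p * x p)"
    using Suc.prems by (intro Suc.IH) auto
  finally show ?case
    by (simp add: distrib_left)
qed

lemma weighted_sum_mono_partial_sums:
  fixes c x y :: "nat \<Rightarrow> 'a::linordered_idom"
  assumes decreasing: "\<And>p. 1 \<le> p \<Longrightarrow> p < m \<Longrightarrow> c (Suc p) \<le> c p"
    and nonneg: "0 \<le> c m"
    and partial_sums: "\<And>t. t \<le> m \<Longrightarrow> (\<Sum>p = 1..t. x p) \<le> (\<Sum>p = 1..t. y p)"
  shows "(\<Sum>p = 1..m. c p * x p) \<le> (\<Sum>p = 1..m. c p * y p)"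
proof -
  have "0 \<le> c m * (\<Sum>p = 1..m. y p - x p)"
    using nonneg partial_sums[of m] by (simp add: sum_subtractf)
  also have "\<dots> \<le> (\<Sum>p = 1..m. c p * (y p - x p))"
    by (rule weighted_sum_ge_last_weight) (use decreasing partial_sums in \<open>simp_all add: sum_subtractf\<close>)
  finally show ?thesis
    by (simp add: right_diff_distrib sum_subtractf)
qed

text \<open>Removing from \<open>N\<close> the head of the list, or an arbitrary element if the head does not occur
  in \<open>N\<close>, removes something at least as large as the head and leaves a part of the tail.\<close>

lemma sum_list_take_le_sum_mset:
  fixes xs :: "'a::{linorder, ordered_comm_monoid_add} list"
  assumes "sorted xs" and "N \<subseteq># mset xs"
  shows "sum_list (take (size N) xs) \<le> sum_mset N"
  using assms
proof (induction xs arbitrary: N)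
  case Nil
  then show ?case by simp
next
  case (Cons x xs)
  show ?case
  proof (cases "N = {#}")
    case True
    then show ?thesis by simp
  next
    case False
    obtain y N' where N: "N = add_mset y N'" and "x \<le> y" and sub: "N' \<subseteq># mset xs"
    proof (cases "x \<in># N")
      case True
      then obtain N' where "N = add_mset x N'"
        by (auto dest: multi_member_split)
      with Cons.prems that[of x N'] show ?thesis by simp
    next
      case x_notin: False
      obtain y N' where N: "N = add_mset y N'"
        using False by (meson multi_member_split multiset_nonemptyE)
      have "N - {#x#} \<subseteq># mset xs"
        using Cons.prems by (simp add: subset_eq_diff_conv)
      then have sub: "N \<subseteq># mset xs"
        using x_notin by (simp add: diff_single_trivial)
      have "y \<in> set xs"
        using mset_subset_eqD[OF sub, of y] N by simp
      moreover have "N' \<subseteq># mset xs"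
        using sub N by (metis mset_subset_eq_insertD subset_mset.less_imp_le)
      ultimately show ?thesis
        using that[of y N'] N Cons.prems by simp
    qed
    have "sum_list (take (size N') xs) \<le> sum_mset N'"
      using Cons.prems sub by (intro Cons.IH) auto
    with \<open>x \<le> y\<close> show ?thesis
      unfolding N by (simp add: add_mono)
  qed
qed

lemma sum_shortest_arc_lengths_le:
  assumes "F \<subseteq> parcs (road_network n)"
  shows "(\<Sum>p = 1..card F. shortest_arc_length n d p) \<le> (\<Sum>(i, j)\<in>F. d i j)"
proof -
  define A where "A = parcs (road_network n)"
  define xs where "xs = sorted_arc_lengths n d"
  define N where "N = image_mset (\<lambda>(i, j). d i j) (mset_set F)"
  have "finite A"
    by (rule finite_subset[of _ "{0..n} \<times> {0..n}"]) (auto simp: A_def road_network_def)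
  then have "finite F"
    using assms finite_subset by (auto simp: A_def)
  have mset_xs: "mset xs = image_mset (\<lambda>(i, j). d i j) (mset_set A)"
    by (simp add: xs_def sorted_arc_lengths_def A_def)
  have "mset_set F \<subseteq># mset_set A"
    using assms \<open>finite A\<close> by (simp add: A_def subset_imp_msubset_mset_set)
  then have sub: "N \<subseteq># mset xs"
    unfolding N_def mset_xs by (rule image_mset_subseteq_mono)
  have size: "size N = card F"
    by (simp add: N_def)
  have len: "card F \<le> length xs"
    using size_mset_mono[OF sub] size by simp
  have "(\<Sum>p = 1..card F. shortest_arc_length n d p) = (\<Sum>p<card F. xs ! p)"
    by (rule sum.reindex_bij_witness[of _ Suc "\<lambda>p. p - 1"])
      (auto simp: shortest_arc_length_def xs_def)
  also have "\<dots> = sum_list (take (size N) xs)"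
    using len by (simp add: size sum_list_sum_nth min_def atLeast0LessThan)
  also have "\<dots> \<le> sum_mset N"
    by (rule sum_list_take_le_sum_mset[OF _ sub]) (simp add: xs_def sorted_arc_lengths_def)
  also have "\<dots> = (\<Sum>(i, j)\<in>F. d i j)"
    by (simp add: N_def sum_unfold_sum_mset)
  finally show ?thesis .
qed

section \<open>Hamiltonian cycles\<close>

lemma consecutive_in_vwalk_arcs:
  "Suc q < length p \<Longrightarrow> (p ! q, p ! Suc q) \<in> set (vwalk_arcs p)"
proof (induction p arbitrary: q rule: vwalk_arcs.induct)
  case (3 x y xs)
  then show ?case by (cases q) auto
qed auto

context
  fixes n :: nat and H :: "nat list"
  assumes cycle: "hamiltonian_cycle n H"
begin

lemma set_tl_hamiltonian_cycle: "set (tl H) = {0..n}"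
proof -
  have H: "H \<noteq> []" "tl H \<noteq> []" "hd H = 0" "last H = 0" "set H = {0..n}"
    using cycle by (auto simp: hamiltonian_cycle_def road_network_def)
  then have "0 \<in> set (tl H)"
    using last_in_set[of "tl H"] by (simp add: last_tl)
  moreover have "set H = insert 0 (set (tl H))"
    using H by (cases H) simp_all
  ultimately show ?thesis
    using H by (simp add: insert_absorb)
qed

lemma length_hamiltonian_cycle: "length H = n + 2"
proof -
  have "length (tl H) = card (set (tl H))" "tl H \<noteq> []"
    using cycle by (auto simp: hamiltonian_cycle_def distinct_card)
  then show ?thesis
    by (simp add: set_tl_hamiltonian_cycle)
qed

lemma hamiltonian_cycle_nth_ends: "H ! 0 = 0" "H ! Suc n = 0"
proof -
  have "H \<noteq> []" "hd H = 0" "last H = 0"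
    using cycle by (auto simp: hamiltonian_cycle_def)
  then show "H ! 0 = 0" "H ! Suc n = 0"
    by (simp_all add: hd_conv_nth last_conv_nth length_hamiltonian_cycle)
qed

lemma inj_on_hamiltonian_cycle: "inj_on ((!) H) {1..Suc n}"
proof (rule inj_onI)
  have "tl H ! (r - 1) = H ! r" if "r \<in> {1..Suc n}" for r
    using that by (cases r) (simp_all add: nth_tl length_hamiltonian_cycle)
  moreover fix p q
  assume "p \<in> {1..Suc n}" "q \<in> {1..Suc n}" "H ! p = H ! q"
  ultimately have "tl H ! (p - 1) = tl H ! (q - 1)"
    by metis
  moreover have "distinct (tl H)"
    using cycle by (simp add: hamiltonian_cycle_def)
  ultimately show "p = q"
    using \<open>p \<in> _\<close> \<open>q \<in> _\<close> by (auto simp: nth_eq_iff_index_eq length_hamiltonian_cycle)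
qed

text \<open>Beyond the end of the list \<open>H ! q\<close> is arbitrary, which is harmless since then \<open>p \<le> q\<close>.\<close>

lemma first_visit_hamiltonian_cycle:
  assumes "p \<in> {1..n}" and "H ! q = H ! p"
  shows "p \<le> q"
proof (rule ccontr)
  assume "\<not> p \<le> q"
  moreover have False if "q = 0"
    using inj_onD[OF inj_on_hamiltonian_cycle, of "Suc n" p] assms that
    by (simp add: hamiltonian_cycle_nth_ends)
  moreover have False if "0 < q" "q < p"
    using inj_onD[OF inj_on_hamiltonian_cycle, of q p] assms that by simp
  ultimately show False by auto
qed

lemma nth_hamiltonian_cycle_customers: "(!) H ` {1..n} = {1..n}"
proof -
  have "(!) H ` {1..n} \<subseteq> {1..n}"
  proof
    fix i
    assume "i \<in> (!) H ` {1..n}"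
    then obtain p where p: "p \<in> {1..n}" "i = H ! p" by auto
    have "i \<in> set H"
      using p length_hamiltonian_cycle by simp
    then have "i \<le> n"
      using cycle by (auto simp: hamiltonian_cycle_def road_network_def)
    moreover have "i \<noteq> 0"
      using first_visit_hamiltonian_cycle[of p 0] p hamiltonian_cycle_nth_ends by auto
    ultimately show "i \<in> {1..n}" by simp
  qed
  moreover have "inj_on ((!) H) {1..n}"
    by (rule inj_on_subset[OF inj_on_hamiltonian_cycle]) auto
  ultimately show ?thesis
    by (simp add: card_image card_subset_eq)
qed

lemma hamiltonian_cycle_arc:
  assumes "q \<in> {1..Suc n}"
  shows "(H ! (q - 1), H ! q) \<in> parcs (road_network n)"
proof -
  have "(H ! (q - 1), H ! Suc (q - 1)) \<in> set (vwalk_arcs H)"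
    using assms by (intro consecutive_in_vwalk_arcs) (auto simp: length_hamiltonian_cycle)
  moreover have "set (vwalk_arcs H) \<subseteq> parcs (road_network n)"
    using cycle by (auto simp: hamiltonian_cycle_def vwalk_def arcs_ends_def arc_to_ends_def)
  ultimately show ?thesis
    using assms by auto
qed

text \<open>The arcs are distinguished by their heads, which the cycle visits only once.\<close>

lemma sum_shortest_arc_lengths_le_cycle_segment:
  assumes "k + t \<le> Suc n"
  shows "(\<Sum>p = 1..t. shortest_arc_length n d p) \<le> (\<Sum>p = 1..t. d (H ! (k + p - 1)) (H ! (k + p)))"
proof -
  define e where "e = (\<lambda>p. (H ! (k + p - 1), H ! (k + p)))"
  have inj: "inj_on e {1..t}"
  proof (rule inj_onI)
    fix p q
    assume "p \<in> {1..t}" "q \<in> {1..t}" "e p = e q"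
    then have "k + p = k + q"
      using assms inj_onD[OF inj_on_hamiltonian_cycle, of "k + p" "k + q"] by (auto simp: e_def)
    then show "p = q" by simp
  qed
  have "e ` {1..t} \<subseteq> parcs (road_network n)"
    using assms hamiltonian_cycle_arc by (force simp: e_def)
  from sum_shortest_arc_lengths_le[OF this, of d] show ?thesis
    using inj by (simp add: card_image sum.reindex e_def)
qed

lemma arrival_time_hamiltonian_cycle:
  assumes "p \<in> {1..n}"
  shows "arrival_time d H (H ! p) = (\<Sum>q = 1..p. d (H ! (q - 1)) (H ! q))"
proof -
  have "(LEAST q. H ! q = H ! p) = p"
    using first_visit_hamiltonian_cycle[OF assms] by (intro Least_equality) auto
  then show ?thesis
    by (simp add: arrival_time_def)
qed

lemma outgoing_prefix_eq_take:
  assumes "outgoing_path n P" and "prefix P H" and "k = card (set P \<inter> {1..n})"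
  shows "P = take (Suc k) H" and "k \<le> n"
proof -
  have "distinct P" "P \<noteq> []" "hd P = 0" and sub: "set P \<subseteq> {0..n}"
    using assms(1) by (auto simp: outgoing_path_def vpath_def vwalk_def road_network_def)
  have "0 \<in> set P"
    using \<open>P \<noteq> []\<close> \<open>hd P = 0\<close> hd_in_set[of P] by simp
  have "set P \<inter> {1..n} = set P - {0}"
    using sub by (auto simp: subset_iff Suc_le_eq)
  then have "k = length P - 1"
    using assms(3) \<open>distinct P\<close> \<open>0 \<in> set P\<close> by (simp add: distinct_card)
  then have "length P = Suc k"
    using \<open>P \<noteq> []\<close> by (cases P) auto
  then show "P = take (Suc k) H"
    using assms(2) by (auto simp: prefix_def)
  show "k \<le> n"
    using card_mono[of "{1..n}" "set P \<inter> {1..n}"] assms(3) by simp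
qed

end

section \<open>Disruption accumulated along arcs\<close>

context prtrp_instance
begin

lemma supplier_is_customer: "i \<rightarrow>\<^sup>*\<^bsub>with_proj T\<^esub> j \<Longrightarrow> i \<in> {1..n}"
  using customers by (auto elim: reachable_in_vertsE)

lemma card_unrepaired_le_unpowered: "card ({1..n} - S) \<le> unpowered T S"
  unfolding unpowered_def
  by (rule card_mono) (auto simp: customers reachable_def)

lemma unpowered_all_repaired:
  assumes "{1..n} \<subseteq> S"
  shows "unpowered T S = 0"
proof -
  have "{j \<in> pverts T. \<exists>i. i \<rightarrow>\<^sup>*\<^bsub>with_proj T\<^esub> j \<and> i \<notin> S} = {}"
    using assms supplier_is_customer by blast
  then show ?thesis
    by (simp only: unpowered_def card.empty)
qed

context
  fixes H :: "nat list"
  assumes cycle: "hamiltonian_cycle n H"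
begin

lemma cycle_arc_nonneg: "q \<in> {1..Suc n} \<Longrightarrow> 0 \<le> d (H ! (q - 1)) (H ! q)"
  using hamiltonian_cycle_arc[OF cycle] travel_time_nonneg by blast

text \<open>Customer \<open>j\<close> is disrupted until the last of its suppliers is repaired, that is, exactly while
  travelling those arcs before which some supplier is still unrepaired.\<close>

lemma disruption_time_eq_sum_arcs:
  assumes "j \<in> pverts T"
  shows "disruption_time d T H j =
    (\<Sum>q = 1..Suc n. if \<exists>i. i \<rightarrow>\<^sup>*\<^bsub>with_proj T\<^esub> j \<and> i \<notin> set (take q H)
      then d (H ! (q - 1)) (H ! q) else 0)"
proof -
  define Q where "Q = {p \<in> {1..n}. H ! p \<rightarrow>\<^sup>*\<^bsub>with_proj T\<^esub> j}"
  define A where "A t = (\<Sum>q = 1..t. d (H ! (q - 1)) (H ! q))" for t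
  define M where "M = Max Q"
  have supplier_position: "\<exists>p\<in>Q. i = H ! p" if "i \<rightarrow>\<^sup>*\<^bsub>with_proj T\<^esub> j" for i
  proof -
    have "i \<in> (!) H ` {1..n}"
      using supplier_is_customer[OF that] nth_hamiltonian_cycle_customers[OF cycle] by simp
    with that show ?thesis by (auto simp: Q_def)
  qed
  have "j \<rightarrow>\<^sup>*\<^bsub>with_proj T\<^esub> j"
    using assms by (simp add: reachable_def)
  then have "finite Q" "Q \<noteq> {}"
    using supplier_position by (auto simp: Q_def)
  then have "M \<in> Q" and M_max: "\<And>p. p \<in> Q \<Longrightarrow> p \<le> M"
    by (simp_all add: M_def)
  then have M: "M \<in> {1..n}" "H ! M \<rightarrow>\<^sup>*\<^bsub>with_proj T\<^esub> j"
    by (simp_all add: Q_def)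
  have "arrival_time d H (H ! p) = A p" if "p \<in> Q" for p
    using that arrival_time_hamiltonian_cycle[OF cycle] by (simp add: Q_def A_def)
  then have "{arrival_time d H i | i. i \<rightarrow>\<^sup>*\<^bsub>with_proj T\<^esub> j} = A ` Q"
    using supplier_position unfolding Q_def by (auto simp: image_iff) metis+
  moreover have "Max (A ` Q) = A M"
  proof (rule Max_eqI)
    fix y
    assume "y \<in> A ` Q"
    then obtain p where p: "p \<in> Q" "y = A p" by auto
    then show "y \<le> A M"
      unfolding p A_def using M_max[OF p(1)] M(1) cycle_arc_nonneg
      by (intro sum_mono2) auto
  qed (use \<open>finite Q\<close> \<open>M \<in> Q\<close> in auto)
  ultimately have "disruption_time d T H j = (\<Sum>q = 1..M. d (H ! (q - 1)) (H ! q))"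
    by (simp add: disruption_time_def A_def)
  also have "\<dots> = (\<Sum>q = 1..Suc n. if q \<le> M then d (H ! (q - 1)) (H ! q) else 0)"
    using M(1) by (intro sum.mono_neutral_cong_left) auto
  also have "\<dots> = (\<Sum>q = 1..Suc n. if \<exists>i. i \<rightarrow>\<^sup>*\<^bsub>with_proj T\<^esub> j \<and> i \<notin> set (take q H)
      then d (H ! (q - 1)) (H ! q) else 0)"
  proof (rule sum.cong)
    fix q
    assume q: "q \<in> {1..Suc n}"
    have "q \<le> M \<longleftrightarrow> (\<exists>i. i \<rightarrow>\<^sup>*\<^bsub>with_proj T\<^esub> j \<and> i \<notin> set (take q H))"
    proof
      assume "q \<le> M"
      have "H ! M \<notin> set (take q H)"
      proof
        assume "H ! M \<in> set (take q H)"
        then obtain p where "p < q" "H ! p = H ! M"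
          by (auto simp: in_set_conv_nth)
        then show False
          using first_visit_hamiltonian_cycle[OF cycle M(1)] \<open>q \<le> M\<close> by fastforce
      qed
      with M(2) show "\<exists>i. i \<rightarrow>\<^sup>*\<^bsub>with_proj T\<^esub> j \<and> i \<notin> set (take q H)" by blast
    next
      assume "\<exists>i. i \<rightarrow>\<^sup>*\<^bsub>with_proj T\<^esub> j \<and> i \<notin> set (take q H)"
      then obtain p where p: "p \<in> Q" "H ! p \<notin> set (take q H)"
        using supplier_position by blast
      have "q \<le> p"
      proof (rule ccontr)
        assume "\<not> q \<le> p"
        then have "p < length (take q H)" "take q H ! p = H ! p"
          using p(1) length_hamiltonian_cycle[OF cycle] by (auto simp: Q_def)
        then show False
          using p(2) nth_mem[of p "take q H"] by simp
      qed
      then show "q \<le> M"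
        using M_max[OF p(1)] by simp
    qed
    then show "(if q \<le> M then d (H ! (q - 1)) (H ! q) else 0) =
      (if \<exists>i. i \<rightarrow>\<^sup>*\<^bsub>with_proj T\<^esub> j \<and> i \<notin> set (take q H) then d (H ! (q - 1)) (H ! q) else 0)"
      by simp
  qed simp
  finally show ?thesis .
qed

text \<open>Double counting of the pairs of an arc of the cycle and a customer without power on it.\<close>

lemma total_disruption_time_eq: "total_disruption_time d T H = path_disruption_time d T H"
proof -
  have "total_disruption_time d T H =
    (\<Sum>j\<in>pverts T. \<Sum>q = 1..Suc n. if \<exists>i. i \<rightarrow>\<^sup>*\<^bsub>with_proj T\<^esub> j \<and> i \<notin> set (take q H)
      then d (H ! (q - 1)) (H ! q) else 0)"
    unfolding total_disruption_time_def
    by (rule sum.cong[OF refl]) (rule disruption_time_eq_sum_arcs)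
  also have "\<dots> =
    (\<Sum>q = 1..Suc n. \<Sum>j\<in>pverts T. if \<exists>i. i \<rightarrow>\<^sup>*\<^bsub>with_proj T\<^esub> j \<and> i \<notin> set (take q H)
      then d (H ! (q - 1)) (H ! q) else 0)"
    by (rule sum.swap)
  also have "\<dots> =
    (\<Sum>q = 1..Suc n. real (unpowered T (set (take q H))) * d (H ! (q - 1)) (H ! q))"
    by (rule sum.cong[OF refl])
      (simp add: unpowered_def customers sum.inter_filter[symmetric] del: One_nat_def)
  finally show ?thesis
    by (simp add: path_disruption_time_def length_hamiltonian_cycle[OF cycle])
qed

lemma unpowered_take_ge:
  assumes "1 \<le> q" and "q \<le> Suc n"
  shows "Suc n - q \<le> unpowered T (set (take q H))"
proof -
  have "(!) H ` {q..n} \<subseteq> {1..n} - set (take q H)"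
  proof
    fix i
    assume "i \<in> (!) H ` {q..n}"
    then obtain p where p: "q \<le> p" "p \<le> n" "i = H ! p" by auto
    then have "i \<in> {1..n}"
      using nth_hamiltonian_cycle_customers[OF cycle] \<open>1 \<le> q\<close> by auto
    moreover have "i \<notin> set (take q H)"
    proof
      assume "i \<in> set (take q H)"
      then obtain r where "r < q" "H ! r = H ! p"
        using p by (auto simp: in_set_conv_nth)
      then show False
        using first_visit_hamiltonian_cycle[OF cycle, of p r] p \<open>1 \<le> q\<close> by simp
    qed
    ultimately show "i \<in> {1..n} - set (take q H)" by simp
  qed
  moreover have "inj_on ((!) H) {q..n}"
    by (rule inj_on_subset[OF inj_on_hamiltonian_cycle[OF cycle]]) (use \<open>1 \<le> q\<close> in auto)
  ultimately have "Suc n - q \<le> card ({1..n} - set (take q H))"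
    using card_mono[of "{1..n} - set (take q H)" "(!) H ` {q..n}"] by (simp add: card_image)
  then show ?thesis
    using card_unrepaired_le_unpowered order_trans by blast
qed

end

end

section \<open>The lower bound\<close>

theorem proposition6:
  fixes n k w :: nat and d :: "nat \<Rightarrow> nat \<Rightarrow> real" and T :: "nat pair_pre_digraph"
    and P H :: "nat list"
  assumes "prtrp_instance n d T"
    and "outgoing_path n P"
    and "k = card (set P \<inter> {1..n})"
    and "w = unpowered T (set P)"
    and "hamiltonian_cycle n H"
    and "prefix P H"
  shows "total_disruption_time d T H \<ge>
    path_disruption_time d T P + real w * shortest_arc_length n d 1
      + (\<Sum>p = 2..n - k. (real n - real k + 1 - real p) * shortest_arc_length n d p)"
proof -
  interpret prtrp_instance n d T by fact
  note cycle = assms(5)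
  have P: "P = take (Suc k) H" and "k \<le> n"
    using outgoing_prefix_eq_take[OF cycle assms(2,6,3)] by auto
  define m where "m = n - k"
  define s where "s = shortest_arc_length n d"
  define l where "l q = d (H ! (q - 1)) (H ! q)" for q
  define U where "U q = real (unpowered T (set (take q H)))" for q
  define c where "c p = (if p = 1 then real w else real n - real k + 1 - real p)" for p
  have l_nonneg: "0 \<le> l q" if "q \<in> {1..Suc n}" for q
    using cycle_arc_nonneg[OF cycle that] by (simp add: l_def)
  have w: "real w = U (Suc k)"
    using assms(4) P by (simp add: U_def)
  have U_ge: "real n + 1 - real q \<le> U q" if "1 \<le> q" "q \<le> Suc n" for q
    using unpowered_take_ge[OF cycle that] that by (simp add: U_def)

  have P_time: "path_disruption_time d T P = (\<Sum>q = 1..k. U q * l q)"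
    unfolding path_disruption_time_def P
    using \<open>k \<le> n\<close> by (intro sum.cong) (auto simp: length_hamiltonian_cycle[OF cycle] U_def l_def min_def)
  \<comment> \<open>The arc \<open>Suc n\<close> back to the depot is dropped.\<close>
  have "(\<Sum>q = 1..k. U q * l q) + (\<Sum>q = Suc k..n. U q * l q) = (\<Sum>q = 1..n. U q * l q)"
    using \<open>k \<le> n\<close> sum.ub_add_nat[of 1 k "\<lambda>q. U q * l q" "n - k"] by simp
  also have "\<dots> \<le> (\<Sum>q = 1..Suc n. U q * l q)"
    using l_nonneg by (simp add: U_def)
  also have "\<dots> = total_disruption_time d T H"
    by (simp add: total_disruption_time_eq[OF cycle] path_disruption_time_def
        length_hamiltonian_cycle[OF cycle] U_def l_def)
  finally have total: "path_disruption_time d T P + (\<Sum>q = Suc k..n. U q * l q)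
      \<le> total_disruption_time d T H"
    by (simp add: P_time)

  have "real w * s 1 + (\<Sum>p = 2..m. (real n - real k + 1 - real p) * s p)
      \<le> (\<Sum>q = Suc k..n. U q * l q)"
  proof (cases "m = 0")
    \<comment> \<open>The cycle only returns to the depot after \<open>P\<close>; the term for \<open>s 1\<close> vanishes since \<open>w = 0\<close>.\<close>
    case True
    then have "set P \<inter> {1..n} = {1..n}"
      using assms(3) \<open>k \<le> n\<close> by (intro card_subset_eq) (auto simp: m_def)
    then have "w = 0"
      using assms(4) unpowered_all_repaired[of "set P"] by (simp add: inf.absorb_iff2)
    with True show ?thesis
      by (simp add: sum_nonneg m_def)
  next
    case False
    have "(\<Sum>p = 2..m. (real n - real k + 1 - real p) * s p) = (\<Sum>p = Suc 1..m. c p * s p)"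
      by (rule sum.cong) (auto simp: c_def)
    then have "real w * s 1 + (\<Sum>p = 2..m. (real n - real k + 1 - real p) * s p)
        = (\<Sum>p = 1..m. c p * s p)"
      using False sum.atLeast_Suc_atMost[of 1 m "\<lambda>p. c p * s p"] by (simp add: c_def)
    also have "\<dots> \<le> (\<Sum>p = 1..m. c p * l (k + p))"
    proof (rule weighted_sum_mono_partial_sums)
      fix p
      assume "1 \<le> p" "p < m"
      then show "c (Suc p) \<le> c p"
        using U_ge[of "Suc k"] w \<open>k \<le> n\<close> by (auto simp: c_def m_def)
    next
      show "0 \<le> c m"
        using False by (simp add: c_def m_def)
    next
      fix t
      assume "t \<le> m"
      then show "(\<Sum>p = 1..t. s p) \<le> (\<Sum>p = 1..t. l (k + p))"
        using sum_shortest_arc_lengths_le_cycle_segment[OF cycle, of k t d] \<open>k \<le> n\<close>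
        by (simp add: s_def l_def m_def)
    qed
    also have "\<dots> \<le> (\<Sum>p = 1..m. U (k + p) * l (k + p))"
    proof (rule sum_mono)
      fix p
      assume p: "p \<in> {1..m}"
      then have "k + p \<le> Suc n"
        by (auto simp: m_def)
      then have "c p \<le> U (k + p)"
        using p U_ge[of "k + p"] w by (auto simp: c_def)
      then show "c p * l (k + p) \<le> U (k + p) * l (k + p)"
        using p l_nonneg[of "k + p"] by (intro mult_right_mono) (auto simp: m_def)
    qed
    also have "\<dots> = (\<Sum>q = Suc k..n. U q * l q)"
      by (rule sum.reindex_bij_witness[of _ "\<lambda>q. q - k" "\<lambda>p. k + p"]) (auto simp: m_def)
    finally show ?thesis .
  qed
  with total show ?thesis
    by (simp add: s_def m_def)
qed

end
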